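(* Let $a\in L^1(I)$. The following identities between Green's functions hold for all $(t,s)\in I\times I$, each one whenever all the boundary value problems whose Green's functions appear in it are nonresonant: 1. $G_D[a,T](t,s)=G_P[\tilde a,2T](t,s)-G_P[\tilde a,2T](2T-t,s)$. 2. $G_D[a,T](t,s)=G_D[\tilde a,2T](t,s)-G_D[\tilde a,2T](2T-t,s)$. 3. $G_D[a,T](t,s)=G_P[\tilde{\tilde a},4T](t,s)-G_P[\tilde{\tilde a},4T](4T-t,s)-G_P[\tilde{\tilde a},4T](2T-t,s)+G_P[\tilde{\tilde a},4T](2T+t,s)$.
   Context: Fix $T>0$ and put $I=[0,T]$. $W^{2,1}(c,d)$ is the set of $u\in C^1[c,d]$ with $u'$ absolutely continuous on $[c,d]$. For $a\in L^1(I)$, $\tilde a$ is its even extension to $[0,2T]$: $\tilde a(t)=a(t)$ on $[0,T]$, $\tilde a(t)=a(2T-t)$ on $(T,2T]$; and $\tilde{\tilde a}$ is the even extension of $\tilde a$ to $[0,4T]$: $\tilde{\tilde a}(t)=\tilde a(t)$ on $[0,2T]$, $\tilde{\tilde a}(t)=\tilde a(4T-t)$ on $(2T,4T]$. For $S>0$ and $q\in L^1(0,S)$ consider $u''(t)+q(t)u(t)=\sigma(t)$ for a.e. $t\in[0,S]$, $u\in W^{2,1}(0,S)$, with one of the boundary conditions: (P) periodic: $u(0)=u(S)$, $u'(0)=u'(S)$; (D) Dirichlet: $u(0)=u(S)=0$. The problem is nonresonant if for $\sigma=0$ it has only the trivial solution; then for every $\sigma\in L^1(0,S)$ it has a unique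 solution, given by $u(t)=\int_0^S G_B[q,S](t,s)\sigma(s)\,ds$ with $B\in\{P,D\}$, where $G_B[q,S]$ is the (unique, continuous on $[0,S]\times[0,S]$) Green's function. *)

theory Defs
  imports "HOL-Analysis.Analysis"
begin

definition abs_cont_on :: "real \<Rightarrow> real \<Rightarrow> (real \<Rightarrow> real) \<Rightarrow> bool" where
  "abs_cont_on c d f \<longleftrightarrow>
     (\<forall>\<epsilon>>0. \<exists>\<delta>>0. \<forall>(n::nat) x y.
        (\<forall>i<n. c \<le> x i \<and> x i \<le> y i \<and> y i \<le> d) \<longrightarrow>
        (\<forall>i<n. \<forall>j<n. i \<noteq> j \<longrightarrow> {x i<..<y i} \<inter> {x j<..<y j} = {}) \<longrightarrow>
        (\<Sum>i<n. y i - x i) < \<delta> \<longrightarrow>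
        (\<Sum>i<n. \<bar>f (y i) - f (x i)\<bar>) < \<epsilon>)"

(* Relative derivative on [c,d], hence one-sided at the endpoints. *)
definition deriv_on :: "real \<Rightarrow> real \<Rightarrow> (real \<Rightarrow> real) \<Rightarrow> real \<Rightarrow> real" where
  "deriv_on c d u t = vector_derivative u (at t within {c..d})"

definition W21 :: "real \<Rightarrow> real \<Rightarrow> (real \<Rightarrow> real) set" where
  "W21 c d = {u. u differentiable_on {c..d} \<and> continuous_on {c..d} (deriv_on c d u)
                 \<and> abs_cont_on c d (deriv_on c d u)}"

datatype bc = Periodic | Dirichlet

fun satisfies_bc :: "bc \<Rightarrow> real \<Rightarrow> (real \<Rightarrow> real) \<Rightarrow> bool" where
  "satisfies_bc Periodic S u \<longleftrightarrow> u 0 = u S \<and> deriv_on 0 S u 0 = deriv_on 0 S u S"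
| "satisfies_bc Dirichlet S u \<longleftrightarrow> u 0 = 0 \<and> u S = 0"

(* Only the restriction of u to [0,S] matters; the value w is u''(t). *)
definition solves :: "bc \<Rightarrow> (real \<Rightarrow> real) \<Rightarrow> real \<Rightarrow> (real \<Rightarrow> real) \<Rightarrow> (real \<Rightarrow> real) \<Rightarrow> bool" where
  "solves B q S \<sigma> u \<longleftrightarrow>
     u \<in> W21 0 S \<and>
     (AE t in lebesgue. t \<in> {0..S} \<longrightarrow>
        (\<exists>w. (deriv_on 0 S u has_real_derivative w) (at t within {0..S}) \<and>
             w + q t * u t = \<sigma> t)) \<and>
     satisfies_bc B S u"

definition nonresonant :: "bc \<Rightarrow> (real \<Rightarrow> real) \<Rightarrow> real \<Rightarrow> bool" where
  "nonresonant B q S \<longleftrightarrow> (\<forall>u. solves B q S (\<lambda>_. 0) u \<longrightarrow> (\<forall>t\<in>{0..S}. u t = 0))"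

(* For a nonresonant problem such a G exists and is unique on the square [0,S] x [0,S];
   its values elsewhere are irrelevant. *)
definition is_green :: "bc \<Rightarrow> (real \<Rightarrow> real) \<Rightarrow> real \<Rightarrow> (real \<Rightarrow> real \<Rightarrow> real) \<Rightarrow> bool" where
  "is_green B q S G \<longleftrightarrow>
     continuous_on ({0..S} \<times> {0..S}) (\<lambda>(t, s). G t s) \<and>
     (\<forall>\<sigma>. set_integrable lebesgue {0..S} \<sigma> \<longrightarrow>
        solves B q S \<sigma> (\<lambda>t. LINT s:{0..S}|lebesgue. G t s * \<sigma> s))"

(* Even extension of a from [0,S] to [0,2S], about t = S. *)
definition even_ext :: "real \<Rightarrow> (real \<Rightarrow> real) \<Rightarrow> real \<Rightarrow> real" where
  "even_ext S a t = (if t \<le> S then a t else a (2 * S - t))"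

end

theory Submission
  imports Defs
begin

text \<open>
  Each right-hand side is a kernel \<open>K(t,s)\<close> built from a Green's function \<open>G\<close> on the longer
  interval \<open>[0,S]\<close> by reflecting or shifting the first variable.  The plan is to recognise
  \<open>K\<close> itself as a Green's function of the Dirichlet problem on \<open>[0,T]\<close>, and then to use that a
  nonresonant problem has only one continuous Green's function (\<open>is_green_unique\<close>).

  Take \<open>\<sigma>\<close> on \<open>[0,T]\<close>, extend it by zero to \<open>[0,S]\<close>, and let \<open>u\<close> be the solution that \<open>G\<close>
  produces for this extension.  The extended coefficient is invariant under the reflections and
  shifts \<open>\<phi>\<close> involved, so every \<open>u \<circ> \<phi>\<close> solves the original equation on \<open>[0,T]\<close>,
  with right-hand side \<open>\<sigma>\<close> for \<open>\<phi>(t) = t\<close> and zero almost everywhere for the other \<open>\<phi>\<close>, which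
  map \<open>[0,T)\<close> outside \<open>[0,T]\<close> (\<open>ode_sol_green\<close>).  Hence
  \<open>w(t) = u(t) - u(2T - t)\<close>, respectively \<open>w(t) = u(t) - u(4T - t) - u(2T - t) + u(2T + t)\<close>,
  solves the equation on \<open>[0,T]\<close> with right-hand side \<open>\<sigma>\<close>.  It vanishes at \<open>T\<close> because
  its terms cancel in pairs there, and at \<open>0\<close> because in addition \<open>u(0) = u(S)\<close>, which both kinds
  of boundary condition imply.
\<close>

section \<open>Absolute continuity and null sets under isometries\<close>

definition disjoint_intervals :: "real \<Rightarrow> real \<Rightarrow> nat \<Rightarrow> (nat \<Rightarrow> real) \<Rightarrow> (nat \<Rightarrow> real) \<Rightarrow> bool" where
  "disjoint_intervals c d n x y \<longleftrightarrow>
     (\<forall>i<n. c \<le> x i \<and> x i \<le> y i \<and> y i \<le> d) \<and>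
     (\<forall>i<n. \<forall>j<n. i \<noteq> j \<longrightarrow> {x i<..<y i} \<inter> {x j<..<y j} = {})"

lemma abs_cont_onI:
  assumes "\<And>e. e > 0 \<Longrightarrow> \<exists>\<delta>>0. \<forall>n x y. disjoint_intervals c d n x y \<longrightarrow>
     (\<Sum>i<n. y i - x i) < \<delta> \<longrightarrow> (\<Sum>i<n. \<bar>f (y i) - f (x i)\<bar>) < e"
  shows "abs_cont_on c d f"
  unfolding abs_cont_on_def
proof (intro allI impI)
  fix e :: real
  assume "0 < e"
  then obtain \<delta> where \<delta>: "\<delta> > 0" "\<forall>n x y. disjoint_intervals c d n x y \<longrightarrow>
     (\<Sum>i<n. y i - x i) < \<delta> \<longrightarrow> (\<Sum>i<n. \<bar>f (y i) - f (x i)\<bar>) < e"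
    using assms[of e] by blast
  show "\<exists>\<delta>>0. \<forall>(n::nat) x y.
        (\<forall>i<n. c \<le> x i \<and> x i \<le> y i \<and> y i \<le> d) \<longrightarrow>
        (\<forall>i<n. \<forall>j<n. i \<noteq> j \<longrightarrow> {x i<..<y i} \<inter> {x j<..<y j} = {}) \<longrightarrow>
        (\<Sum>i<n. y i - x i) < \<delta> \<longrightarrow> (\<Sum>i<n. \<bar>f (y i) - f (x i)\<bar>) < e"
    by (rule exI[of _ \<delta>], rule conjI[OF \<delta>(1)], intro allI impI,
        rule \<delta>(2)[rule_format], unfold disjoint_intervals_def) (rule conjI)
qed

lemma abs_cont_onE:
  assumes "abs_cont_on c d f" "e > 0"
  obtains \<delta> where "\<delta> > 0"
    "\<And>n x y. disjoint_intervals c d n x y \<Longrightarrow>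
       (\<Sum>i<n. y i - x i) < \<delta> \<Longrightarrow> (\<Sum>i<n. \<bar>f (y i) - f (x i)\<bar>) < e"
proof -
  from assms obtain \<delta> where \<delta>: "\<delta> > 0" "\<forall>(n::nat) x y.
        (\<forall>i<n. c \<le> x i \<and> x i \<le> y i \<and> y i \<le> d) \<longrightarrow>
        (\<forall>i<n. \<forall>j<n. i \<noteq> j \<longrightarrow> {x i<..<y i} \<inter> {x j<..<y j} = {}) \<longrightarrow>
        (\<Sum>i<n. y i - x i) < \<delta> \<longrightarrow> (\<Sum>i<n. \<bar>f (y i) - f (x i)\<bar>) < e"
    unfolding abs_cont_on_def by (elim allE[of _ e]) (elim impE exE conjE)
  show thesis
  proof (rule that[OF \<delta>(1)])
    fix n x y
    assume "disjoint_intervals c d n x y" and small: "(\<Sum>i<n. y i - x i) < \<delta>"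
    then have "\<forall>i<n. c \<le> x i \<and> x i \<le> y i \<and> y i \<le> d"
      "\<forall>i<n. \<forall>j<n. i \<noteq> j \<longrightarrow> {x i<..<y i} \<inter> {x j<..<y j} = {}"
      unfolding disjoint_intervals_def by simp_all
    from \<delta>(2)[THEN spec, THEN spec, THEN spec, THEN mp, OF this(1), THEN mp, OF this(2), THEN mp, OF small]
    show "(\<Sum>i<n. \<bar>f (y i) - f (x i)\<bar>) < e" .
  qed
qed

lemma abs_cont_on_cong:
  assumes f: "abs_cont_on c d f" and eq: "\<And>t. t \<in> {c..d} \<Longrightarrow> f t = g t"
  shows "abs_cont_on c d g"
proof (rule abs_cont_onI)
  fix e :: real
  assume "0 < e"
  then obtain \<delta> where \<delta>: "\<delta> > 0"
    "\<And>n x y. disjoint_intervals c d n x y \<Longrightarrow>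
       (\<Sum>i<n. y i - x i) < \<delta> \<Longrightarrow> (\<Sum>i<n. \<bar>f (y i) - f (x i)\<bar>) < e"
    by (rule abs_cont_onE[OF f]) (rule that)
  have "(\<Sum>i<n. \<bar>g (y i) - g (x i)\<bar>) < e"
    if A: "disjoint_intervals c d n x y" and C: "(\<Sum>i<n. y i - x i) < \<delta>" for n x y
  proof -
    have "(\<Sum>i<n. \<bar>g (y i) - g (x i)\<bar>) = (\<Sum>i<n. \<bar>f (y i) - f (x i)\<bar>)"
    proof (rule sum.cong)
      fix i assume "i \<in> {..<n}"
      then have "x i \<in> {c..d}" "y i \<in> {c..d}"
        using A unfolding disjoint_intervals_def by force+
      then show "\<bar>g (y i) - g (x i)\<bar> = \<bar>f (y i) - f (x i)\<bar>"
        using eq by simp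
    qed simp
    with \<delta>(2)[OF A C] show ?thesis by simp
  qed
  with \<delta>(1) show "\<exists>\<delta>>0. \<forall>n x y. disjoint_intervals c d n x y \<longrightarrow>
       (\<Sum>i<n. y i - x i) < \<delta> \<longrightarrow> (\<Sum>i<n. \<bar>g (y i) - g (x i)\<bar>) < e"
    by (intro exI[of _ \<delta>]) simp
qed

lemma abs_cont_on_lincomb:
  assumes f: "abs_cont_on c d f" and g: "abs_cont_on c d g"
  shows "abs_cont_on c d (\<lambda>t. p * f t + r * g t)"
proof (rule abs_cont_onI)
  fix e :: real
  assume e: "0 < e"
  define m where "m = \<bar>p\<bar> + \<bar>r\<bar> + 1"
  have m: "m > 0" by (simp add: m_def)
  then have em: "0 < e / m" using e by simp
  obtain \<delta>1 where \<delta>1: "\<delta>1 > 0"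
    "\<And>n x y. disjoint_intervals c d n x y \<Longrightarrow>
       (\<Sum>i<n. y i - x i) < \<delta>1 \<Longrightarrow> (\<Sum>i<n. \<bar>f (y i) - f (x i)\<bar>) < e / m"
    by (rule abs_cont_onE[OF f em]) (rule that)
  obtain \<delta>2 where \<delta>2: "\<delta>2 > 0"
    "\<And>n x y. disjoint_intervals c d n x y \<Longrightarrow>
       (\<Sum>i<n. y i - x i) < \<delta>2 \<Longrightarrow> (\<Sum>i<n. \<bar>g (y i) - g (x i)\<bar>) < e / m"
    by (rule abs_cont_onE[OF g em]) (rule that)
  have "(\<Sum>i<n. \<bar>(p * f (y i) + r * g (y i)) - (p * f (x i) + r * g (x i))\<bar>) < e"
    if A: "disjoint_intervals c d n x y" and C: "(\<Sum>i<n. y i - x i) < min \<delta>1 \<delta>2" for n x y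
  proof -
    let ?F = "\<Sum>i<n. \<bar>f (y i) - f (x i)\<bar>" and ?G = "\<Sum>i<n. \<bar>g (y i) - g (x i)\<bar>"
    have F: "?F < e / m" and G: "?G < e / m"
      using \<delta>1(2)[OF A] \<delta>2(2)[OF A] C by auto
    have "(\<Sum>i<n. \<bar>(p * f (y i) + r * g (y i)) - (p * f (x i) + r * g (x i))\<bar>)
          \<le> (\<Sum>i<n. \<bar>p\<bar> * \<bar>f (y i) - f (x i)\<bar> + \<bar>r\<bar> * \<bar>g (y i) - g (x i)\<bar>)"
    proof (rule sum_mono)
      fix i
      have "(p * f (y i) + r * g (y i)) - (p * f (x i) + r * g (x i))
            = p * (f (y i) - f (x i)) + r * (g (y i) - g (x i))"
        by (simp add: algebra_simps)
      then show "\<bar>(p * f (y i) + r * g (y i)) - (p * f (x i) + r * g (x i))\<bar>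
            \<le> \<bar>p\<bar> * \<bar>f (y i) - f (x i)\<bar> + \<bar>r\<bar> * \<bar>g (y i) - g (x i)\<bar>"
        by (metis abs_mult abs_triangle_ineq)
    qed
    also have "\<dots> = \<bar>p\<bar> * ?F + \<bar>r\<bar> * ?G"
      by (simp add: sum.distrib sum_distrib_left)
    also have "\<dots> \<le> \<bar>p\<bar> * (e / m) + \<bar>r\<bar> * (e / m)"
      using F G by (intro add_mono mult_left_mono) auto
    also have "\<dots> < m * (e / m)"
      unfolding distrib_right[symmetric] using em by (intro mult_strict_right_mono) (simp_all add: m_def)
    also have "\<dots> = e" using m by simp
    finally show ?thesis .
  qed
  moreover have "min \<delta>1 \<delta>2 > 0" using \<delta>1(1) \<delta>2(1) by simp
  ultimately show "\<exists>\<delta>>0. \<forall>n x y. disjoint_intervals c d n x y \<longrightarrow>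
        (\<Sum>i<n. y i - x i) < \<delta> \<longrightarrow>
        (\<Sum>i<n. \<bar>(p * f (y i) + r * g (y i)) - (p * f (x i) + r * g (x i))\<bar>) < e"
    by (intro exI[of _ "min \<delta>1 \<delta>2"]) simp
qed

text \<open>
  An isometry of the line carries disjoint intervals to disjoint intervals of the same length;
  a reflection swaps their endpoints, which the absolute values do not notice.
\<close>

lemma abs_cont_on_isometry:
  assumes f: "abs_cont_on c d f"
    and k: "k = 1 \<or> k = -1"
    and into: "\<And>t. t \<in> {c'..d'} \<Longrightarrow> b + k * t \<in> {c..d}"
  shows "abs_cont_on c' d' (\<lambda>t. f (b + k * t))"
proof (rule abs_cont_onI)
  fix e :: real
  assume "0 < e"
  then obtain \<delta> where \<delta>: "\<delta> > 0"
    "\<And>n x y. disjoint_intervals c d n x y \<Longrightarrow>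
       (\<Sum>i<n. y i - x i) < \<delta> \<Longrightarrow> (\<Sum>i<n. \<bar>f (y i) - f (x i)\<bar>) < e"
    by (rule abs_cont_onE[OF f]) (rule that)
  have "(\<Sum>i<n. \<bar>f (b + k * y i) - f (b + k * x i)\<bar>) < e"
    if A: "disjoint_intervals c' d' n x y" and C: "(\<Sum>i<n. y i - x i) < \<delta>" for n x y
  proof -
    define x' where "x' = (\<lambda>i. if k = 1 then b + x i else b - y i)"
    define y' where "y' = (\<lambda>i. if k = 1 then b + y i else b - x i)"
    have 1: "\<forall>i<n. c \<le> x' i \<and> x' i \<le> y' i \<and> y' i \<le> d"
    proof (intro allI impI)
      fix i assume "i < n"
      then have *: "c' \<le> x i" "x i \<le> y i" "y i \<le> d'" using A by (auto simp: disjoint_intervals_def)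
      then show "c \<le> x' i \<and> x' i \<le> y' i \<and> y' i \<le> d"
        using into[of "x i"] into[of "y i"] k by (auto simp: x'_def y'_def)
    qed
    have 2: "\<forall>i<n. \<forall>j<n. i \<noteq> j \<longrightarrow> {x' i<..<y' i} \<inter> {x' j<..<y' j} = {}"
    proof (intro allI impI)
      fix i j assume ij: "i < n" "j < n" "i \<noteq> j"
      have pre: "k * (z - b) \<in> {x l<..<y l}" if "z \<in> {x' l<..<y' l}" for z l
        using that k by (auto simp: x'_def y'_def)
      show "{x' i<..<y' i} \<inter> {x' j<..<y' j} = {}"
        using pre A ij unfolding disjoint_intervals_def by blast
    qed
    have 12: "disjoint_intervals c d n x' y'"
      using 1 2 by (simp add: disjoint_intervals_def)
    have 3: "(\<Sum>i<n. y' i - x' i) < \<delta>"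
      using C k by (auto simp: x'_def y'_def)
    have "(\<Sum>i<n. \<bar>f (b + k * y i) - f (b + k * x i)\<bar>) = (\<Sum>i<n. \<bar>f (y' i) - f (x' i)\<bar>)"
      using k by (intro sum.cong) (auto simp: x'_def y'_def abs_minus_commute)
    with \<delta>(2)[OF 12 3] show ?thesis by simp
  qed
  with \<delta>(1) show "\<exists>\<delta>>0. \<forall>n x y. disjoint_intervals c' d' n x y \<longrightarrow>
        (\<Sum>i<n. y i - x i) < \<delta> \<longrightarrow> (\<Sum>i<n. \<bar>f (b + k * y i) - f (b + k * x i)\<bar>) < e"
    by (intro exI[of _ \<delta>]) simp
qed

lemma AE_lebesgue_affine:
  fixes b k :: real
  assumes P: "AE t in lebesgue. P t" and k: "k \<noteq> 0"
  shows "AE t in lebesgue. P (b + k * t)"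
proof -
  obtain N where N: "negligible N" "{t. \<not> P t} \<subseteq> N"
    using P by (auto simp: eventually_ae_filter negligible_iff_null_sets)
  have "negligible ((\<lambda>z. (z - b) / k) ` N)"
    using N(1) by (intro negligible_differentiable_image_negligible)
      (auto simp: k differentiable_on_def intro!: derivative_intros)
  moreover have "{t. \<not> P (b + k * t)} \<subseteq> (\<lambda>z. (z - b) / k) ` N"
  proof
    fix t assume "t \<in> {t. \<not> P (b + k * t)}"
    then have "b + k * t \<in> N" using N(2) by auto
    moreover have "t = ((b + k * t) - b) / k" using k by simp
    ultimately show "t \<in> (\<lambda>z. (z - b) / k) ` N" by blast
  qed
  ultimately show ?thesis
    by (auto simp: eventually_ae_filter negligible_iff_null_sets)
qed

lemma AE_lebesgue_neq: "AE t in lebesgue. t \<noteq> (c::real)"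
  using AE_completion[OF AE_lborel_singleton[of c]] .

section \<open>Solutions of the equation\<close>

text \<open>
  The equation without boundary conditions.  Naming the derivative \<open>u'\<close> replaces the choice
  operator in \<open>deriv_on\<close> by a derivative that can be computed with.
\<close>

definition ode_sol ::
  "(real \<Rightarrow> real) \<Rightarrow> real \<Rightarrow> (real \<Rightarrow> real) \<Rightarrow> (real \<Rightarrow> real) \<Rightarrow> (real \<Rightarrow> real) \<Rightarrow> bool" where
  "ode_sol q S \<sigma> u u' \<longleftrightarrow>
     (\<forall>t\<in>{0..S}. (u has_real_derivative u' t) (at t within {0..S})) \<and>
     continuous_on {0..S} u' \<and> abs_cont_on 0 S u' \<and>
     (AE t in lebesgue. t \<in> {0..S} \<longrightarrow>
        (\<exists>w. (u' has_real_derivative w) (at t within {0..S}) \<and> w + q t * u t = \<sigma> t))"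

lemma deriv_on_eqI:
  assumes "c < d" "t \<in> {c..d}" "(u has_real_derivative D) (at t within {c..d})"
  shows "deriv_on c d u t = D"
  using assms unfolding deriv_on_def
  by (intro vector_derivative_within_closed_interval)
     (auto simp: has_real_derivative_iff_has_vector_derivative)

lemma has_derivative_transform_real:
  assumes "(f has_real_derivative D) (at t within X)" "t \<in> X" "\<And>x. x \<in> X \<Longrightarrow> f x = g x"
  shows "(g has_real_derivative D) (at t within X)"
  by (rule has_field_derivative_transform_within[OF assms(1) zero_less_one assms(2)]) (rule assms(3))

lemma solves_imp_ode_sol:
  assumes S: "0 < S" and u: "solves B q S \<sigma> u"
  shows "ode_sol q S \<sigma> u (deriv_on 0 S u)"
proof -
  have W: "u \<in> W21 0 S" using u by (simp add: solves_def)
  have "(u has_real_derivative deriv_on 0 S u t) (at t within {0..S})" if t: "t \<in> {0..S}" for t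
  proof -
    have "u differentiable (at t within {0..S})"
      using W t by (auto simp: W21_def differentiable_on_def)
    then obtain D where "(u has_real_derivative D) (at t within {0..S})"
      by (auto simp: real_differentiable_def)
    with deriv_on_eqI[OF S t this] show ?thesis by simp
  qed
  then show ?thesis
    using u W by (auto simp: solves_def ode_sol_def W21_def)
qed

lemma ode_sol_imp_solves:
  assumes S: "0 < S" and u: "ode_sol q S \<sigma> u u'" and bc: "satisfies_bc B S u"
  shows "solves B q S \<sigma> u"
proof -
  have eq: "deriv_on 0 S u t = u' t" if "t \<in> {0..S}" for t
    using deriv_on_eqI[OF S that] u that by (auto simp: ode_sol_def)
  have "u differentiable_on {0..S}"
    using u by (auto simp: ode_sol_def differentiable_on_def real_differentiable_def)
  moreover have "continuous_on {0..S} (deriv_on 0 S u)"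
    using u eq by (subst continuous_on_cong[OF refl eq]) (auto simp: ode_sol_def)
  moreover have "abs_cont_on 0 S (deriv_on 0 S u)"
    by (rule abs_cont_on_cong[where f = u']) (use u eq in \<open>auto simp: ode_sol_def\<close>)
  moreover have "AE t in lebesgue. t \<in> {0..S} \<longrightarrow>
     (\<exists>w. (deriv_on 0 S u has_real_derivative w) (at t within {0..S}) \<and> w + q t * u t = \<sigma> t)"
  proof -
    have "AE t in lebesgue. t \<in> {0..S} \<longrightarrow>
       (\<exists>w. (u' has_real_derivative w) (at t within {0..S}) \<and> w + q t * u t = \<sigma> t)"
      using u by (simp add: ode_sol_def)
    then show ?thesis
    proof (rule AE_mp, intro AE_I2 impI)
      fix t
      assume "t \<in> {0..S} \<longrightarrow>
         (\<exists>w. (u' has_real_derivative w) (at t within {0..S}) \<and> w + q t * u t = \<sigma> t)"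
        and t: "t \<in> {0..S}"
      then obtain w where w: "(u' has_real_derivative w) (at t within {0..S})"
        "w + q t * u t = \<sigma> t" by blast
      show "\<exists>w. (deriv_on 0 S u has_real_derivative w) (at t within {0..S}) \<and> w + q t * u t = \<sigma> t"
        using has_derivative_transform_real[OF w(1) t, of "deriv_on 0 S u"] eq w(2) by auto
    qed
  qed
  ultimately show ?thesis
    using bc by (simp add: solves_def W21_def)
qed

lemma ode_sol_cong:
  assumes u: "ode_sol q S \<sigma> u u'"
    and uv: "\<And>t. t \<in> {0..S} \<Longrightarrow> u t = v t"
    and \<sigma>: "AE t in lebesgue. t \<in> {0..S} \<longrightarrow> \<sigma> t = \<tau> t"
  shows "ode_sol q S \<tau> v u'"
proof -
  have "AE t in lebesgue. t \<in> {0..S} \<longrightarrow>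
     (\<exists>w. (u' has_real_derivative w) (at t within {0..S}) \<and> w + q t * u t = \<sigma> t)"
    using u by (simp add: ode_sol_def)
  then have "AE t in lebesgue. t \<in> {0..S} \<longrightarrow>
     (\<exists>w. (u' has_real_derivative w) (at t within {0..S}) \<and> w + q t * v t = \<tau> t)"
    using \<sigma> by eventually_elim (use uv in auto)
  moreover have "(v has_real_derivative u' t) (at t within {0..S})" if "t \<in> {0..S}" for t
    using has_derivative_transform_real[OF _ that uv] u that by (auto simp: ode_sol_def)
  ultimately show ?thesis
    using u by (simp add: ode_sol_def)
qed

lemma ode_sol_lincomb:
  assumes u: "ode_sol q S \<sigma> u u'" and v: "ode_sol q S \<tau> v v'"
  shows "ode_sol q S (\<lambda>t. p * \<sigma> t + r * \<tau> t) (\<lambda>t. p * u t + r * v t) (\<lambda>t. p * u' t + r * v' t)"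
proof -
  have "AE t in lebesgue. t \<in> {0..S} \<longrightarrow>
     (\<exists>w. (u' has_real_derivative w) (at t within {0..S}) \<and> w + q t * u t = \<sigma> t)"
   "AE t in lebesgue. t \<in> {0..S} \<longrightarrow>
     (\<exists>w. (v' has_real_derivative w) (at t within {0..S}) \<and> w + q t * v t = \<tau> t)"
    using u v by (simp_all add: ode_sol_def)
  then have "AE t in lebesgue. t \<in> {0..S} \<longrightarrow>
     (\<exists>w. ((\<lambda>t. p * u' t + r * v' t) has_real_derivative w) (at t within {0..S}) \<and>
          w + q t * (p * u t + r * v t) = p * \<sigma> t + r * \<tau> t)"
  proof eventually_elim
    case (elim t)
    show ?case
    proof
      assume "t \<in> {0..S}"
      then obtain w z where
        w: "(u' has_real_derivative w) (at t within {0..S})" "w + q t * u t = \<sigma> t" and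
        z: "(v' has_real_derivative z) (at t within {0..S})" "z + q t * v t = \<tau> t"
        using elim by blast
      have "((\<lambda>t. p * u' t + r * v' t) has_real_derivative p * w + r * z) (at t within {0..S})"
        by (intro DERIV_add DERIV_cmult w z)
      moreover have "p * w + r * z + q t * (p * u t + r * v t) = p * \<sigma> t + r * \<tau> t"
        unfolding w(2)[symmetric] z(2)[symmetric] by (simp add: algebra_simps)
      ultimately show "\<exists>w. ((\<lambda>t. p * u' t + r * v' t) has_real_derivative w) (at t within {0..S}) \<and>
          w + q t * (p * u t + r * v t) = p * \<sigma> t + r * \<tau> t" by blast
    qed
  qed
  moreover have "((\<lambda>t. p * u t + r * v t) has_real_derivative p * u' t + r * v' t) (at t within {0..S})"
    if "t \<in> {0..S}" for t
    using u v that by (intro DERIV_add DERIV_cmult) (auto simp: ode_sol_def)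
  ultimately show ?thesis
    using u v by (simp add: ode_sol_def abs_cont_on_lincomb continuous_on_add continuous_on_mult_left)
qed

lemma has_real_derivative_isometry:
  fixes k :: real
  assumes f: "(f has_real_derivative D) (at (b + k * t) within X)"
    and into: "\<And>t. t \<in> Y \<Longrightarrow> b + k * t \<in> X"
  shows "((\<lambda>t. f (b + k * t)) has_real_derivative k * D) (at t within Y)"
proof -
  have "(f has_real_derivative D) (at (b + k * t) within (\<lambda>t. b + k * t) ` Y)"
    using f by (rule DERIV_subset) (use into in auto)
  moreover have "((\<lambda>t. b + k * t) has_real_derivative k) (at t within Y)"
    by (auto intro!: derivative_eq_intros)
  ultimately show ?thesis
    using DERIV_image_chain[of f D "\<lambda>t. b + k * t" t Y k] by (simp add: o_def mult.commute)
qed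

text \<open>
  The equation has second order and no first-order term, so it is invariant under reflections
  as well as under translations: the factor \<open>k\<close> enters the second derivative squared.
\<close>

lemma ode_sol_isometry:
  assumes u: "ode_sol p S \<sigma> u u'"
    and k: "k = 1 \<or> k = -1"
    and into: "\<And>t. t \<in> {0..T} \<Longrightarrow> b + k * t \<in> {0..S}"
    and q: "\<And>t. t \<in> {0..T} \<Longrightarrow> q t = p (b + k * t)"
  shows "ode_sol q T (\<lambda>t. \<sigma> (b + k * t)) (\<lambda>t. u (b + k * t)) (\<lambda>t. k * u' (b + k * t))"
proof -
  have k0: "k \<noteq> 0" and kk: "k * (k * w) = w" for w using k by auto
  have "AE t in lebesgue. t \<in> {0..S} \<longrightarrow>
     (\<exists>w. (u' has_real_derivative w) (at t within {0..S}) \<and> w + p t * u t = \<sigma> t)"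
    using u by (simp add: ode_sol_def)
  from AE_lebesgue_affine[OF this k0, of b]
  have "AE t in lebesgue. t \<in> {0..T} \<longrightarrow>
     (\<exists>w. ((\<lambda>t. k * u' (b + k * t)) has_real_derivative w) (at t within {0..T}) \<and>
          w + q t * u (b + k * t) = \<sigma> (b + k * t))"
  proof eventually_elim
    case (elim t)
    show ?case
    proof
      assume t: "t \<in> {0..T}"
      then obtain w where w: "(u' has_real_derivative w) (at (b + k * t) within {0..S})"
        "w + p (b + k * t) * u (b + k * t) = \<sigma> (b + k * t)"
        using elim into by blast
      have "((\<lambda>t. k * u' (b + k * t)) has_real_derivative k * (k * w)) (at t within {0..T})"
        by (intro DERIV_cmult has_real_derivative_isometry[OF w(1)] into)
      then show "\<exists>w. ((\<lambda>t. k * u' (b + k * t)) has_real_derivative w) (at t within {0..T}) \<and>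
          w + q t * u (b + k * t) = \<sigma> (b + k * t)"
        using w(2) q[OF t] kk by auto
    qed
  qed
  moreover have "((\<lambda>t. u (b + k * t)) has_real_derivative k * u' (b + k * t)) (at t within {0..T})"
    if "t \<in> {0..T}" for t
    using u into that by (intro has_real_derivative_isometry[where X = "{0..S}"]) (auto simp: ode_sol_def)
  moreover have "continuous_on {0..T} (\<lambda>t. u' (b + k * t))"
  proof (rule continuous_on_compose2[where f = "\<lambda>t. b + k * t" and t = "{0..S}"])
    show "continuous_on {0..S} u'" using u by (simp add: ode_sol_def)
    show "continuous_on {0..T} (\<lambda>t. b + k * t)" by (intro continuous_intros)
    show "(\<lambda>t. b + k * t) ` {0..T} \<subseteq> {0..S}" using into by blast
  qed
  moreover have "abs_cont_on 0 T (\<lambda>t. k * u' (b + k * t) + 0 * u' (b + k * t))"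
  proof -
    have "abs_cont_on 0 S u'" using u by (simp add: ode_sol_def)
    from abs_cont_on_isometry[OF this k into] have "abs_cont_on 0 T (\<lambda>t. u' (b + k * t))" .
    from abs_cont_on_lincomb[OF this this] show ?thesis .
  qed
  ultimately show ?thesis
    by (simp add: ode_sol_def continuous_on_mult_left)
qed

section \<open>Green's functions\<close>

lemma continuous_on_green_slice:
  fixes G :: "real \<Rightarrow> real \<Rightarrow> real"
  assumes G: "continuous_on ({0..S} \<times> {0..S}) (\<lambda>(t, s). G t s)" and r: "r \<in> {0..S}"
  shows "continuous_on {0..S} (G r)"
proof -
  have p: "continuous_on {0..S} (\<lambda>s. (r, s))"
    by (intro continuous_intros)
  have "(\<lambda>s. (r, s)) ` {0..S} \<subseteq> {0..S} \<times> {0..S}" using r by blast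
  from continuous_on_compose2[OF G p this] show ?thesis by simp
qed

lemma set_integrable_green:
  fixes G :: "real \<Rightarrow> real \<Rightarrow> real"
  assumes G: "continuous_on ({0..S} \<times> {0..S}) (\<lambda>(t, s). G t s)"
    and r: "r \<in> {0..S}" and T: "T \<le> S" and \<sigma>: "set_integrable lebesgue {0..T} \<sigma>"
  shows "set_integrable lebesgue {0..T} (\<lambda>s. G r s * \<sigma> s)"
proof -
  have c: "continuous_on {0..T} (G r)"
    using continuous_on_green_slice[OF G r] by (rule continuous_on_subset) (use T in auto)
  show ?thesis
  proof (rule absolutely_integrable_bounded_measurable_product_real[OF _ _ _ \<sigma>])
    show "G r \<in> borel_measurable (lebesgue_on {0..T})"
      using c by (simp add: continuous_imp_measurable_on_sets_lebesgue)
    show "bounded (G r ` {0..T})"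
      using c by (simp add: compact_continuous_image compact_imp_bounded)
  qed simp
qed

text \<open>
  By nonresonance \<open>G\<close> and \<open>H\<close> produce the same solution for every right-hand side, so in its
  second variable \<open>G - H\<close> is orthogonal to every integrable function.  Taking \<open>G - H\<close> itself
  as that function, the integral of its square vanishes, and continuity gives \<open>G = H\<close> everywhere.
\<close>

lemma is_green_unique:
  assumes S: "0 < S" and nr: "nonresonant B q S"
    and G: "is_green B q S G" and H: "is_green B q S H"
    and t: "t \<in> {0..S}" and s: "s \<in> {0..S}"
  shows "G t s = H t s"
proof -
  have cG: "continuous_on ({0..S} \<times> {0..S}) (\<lambda>(t, s). G t s)"
    and cH: "continuous_on ({0..S} \<times> {0..S}) (\<lambda>(t, s). H t s)"
    using G H by (auto simp: is_green_def)
  define \<sigma> where "\<sigma> = (\<lambda>s. G t s - H t s)"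
  have c\<sigma>: "continuous_on {0..S} \<sigma>"
    unfolding \<sigma>_def
    by (intro continuous_on_diff continuous_on_green_slice[OF cG t] continuous_on_green_slice[OF cH t])
  have i\<sigma>: "set_integrable lebesgue {0..S} \<sigma>"
    using c\<sigma> by (rule absolutely_integrable_continuous_real)
  let ?u = "\<lambda>t. LINT s:{0..S}|lebesgue. G t s * \<sigma> s"
  let ?v = "\<lambda>t. LINT s:{0..S}|lebesgue. H t s * \<sigma> s"
  have u: "solves B q S \<sigma> ?u" and v: "solves B q S \<sigma> ?v"
    using G H i\<sigma> by (auto simp: is_green_def)
  let ?u' = "deriv_on 0 S ?u" and ?v' = "deriv_on 0 S ?v"
  have ode: "ode_sol q S (\<lambda>_. 0) (\<lambda>t. 1 * ?u t + (-1) * ?v t) (\<lambda>t. 1 * ?u' t + (-1) * ?v' t)"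
    using ode_sol_lincomb[OF solves_imp_ode_sol[OF S u] solves_imp_ode_sol[OF S v], of 1 "-1"] by simp
  have "deriv_on 0 S (\<lambda>t. 1 * ?u t + (-1) * ?v t) r = 1 * ?u' r + (-1) * ?v' r" if "r \<in> {0..S}" for r
    using deriv_on_eqI[OF S that] ode that by (auto simp: ode_sol_def)
  then have "satisfies_bc B S (\<lambda>t. 1 * ?u t + (-1) * ?v t)"
    using u v S by (cases B) (auto simp: solves_def)
  from ode_sol_imp_solves[OF S ode this] have uv: "?u t = ?v t"
    using nr t unfolding nonresonant_def by fastforce
  have "integral {0..S} (\<lambda>s. \<sigma> s * \<sigma> s) = (LINT s:{0..S}|lebesgue. \<sigma> s * \<sigma> s)"
    using c\<sigma> by (intro set_lebesgue_integral_eq_integral(2)[symmetric]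
        absolutely_integrable_continuous_real continuous_on_mult)
  also have "\<dots> = ?u t - ?v t"
    using set_integral_diff(2)[OF set_integrable_green[OF cG t order_refl i\<sigma>]
        set_integrable_green[OF cH t order_refl i\<sigma>]]
    by (simp add: \<sigma>_def left_diff_distrib)
  finally have "integral {0..S} (\<lambda>s. \<sigma> s * \<sigma> s) = 0" using uv by simp
  then have "\<sigma> s * \<sigma> s = 0"
    using integral_eq_0_iff[of 0 S "\<lambda>s. \<sigma> s * \<sigma> s"] continuous_on_mult[OF c\<sigma> c\<sigma>] S s by simp
  then show ?thesis by (simp add: \<sigma>_def)
qed

text \<open>
  The bridge between the two intervals: extending \<open>\<sigma>\<close> by zero does not change the integral,
  so solutions on \<open>[0,S]\<close> can be written as integrals over \<open>[0,T]\<close>.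
\<close>

lemma solves_green_zero_extension:
  assumes G: "is_green B p S G" and T: "T \<le> S" and \<sigma>: "set_integrable lebesgue {0..T} \<sigma>"
  shows "solves B p S (\<lambda>t. if t \<le> T then \<sigma> t else 0) (\<lambda>t. LINT s:{0..T}|lebesgue. G t s * \<sigma> s)"
proof -
  let ?\<sigma> = "\<lambda>t. if t \<le> T then \<sigma> t else 0"
  have "indicat_real {0..S} x *\<^sub>R ?\<sigma> x = indicat_real {0..T} x *\<^sub>R \<sigma> x" for x
    using T by (simp add: indicator_def)
  then have "set_integrable lebesgue {0..S} ?\<sigma>"
    using \<sigma> unfolding set_integrable_def by presburger
  moreover have "\<forall>\<sigma>. set_integrable lebesgue {0..S} \<sigma> \<longrightarrow>
      solves B p S \<sigma> (\<lambda>t. LINT s:{0..S}|lebesgue. G t s * \<sigma> s)"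
    using G unfolding is_green_def by (rule conjunct2)
  ultimately have "solves B p S ?\<sigma> (\<lambda>t. LINT s:{0..S}|lebesgue. G t s * ?\<sigma> s)"
    by (elim allE[of _ ?\<sigma>]) (rule mp)
  moreover have "(LINT s:{0..S}|lebesgue. G t s * ?\<sigma> s) = (LINT s:{0..T}|lebesgue. G t s * \<sigma> s)" for t
    unfolding set_lebesgue_integral_def
    using T by (intro Bochner_Integration.integral_cong) (auto simp: indicator_def)
  ultimately show ?thesis by simp
qed

lemma ode_sol_green:
  assumes S: "0 < S" and G: "is_green B p S G" and T: "T \<le> S"
    and \<sigma>: "set_integrable lebesgue {0..T} \<sigma>"
    and k: "k = 1 \<or> k = -1"
    and into: "\<And>t. t \<in> {0..T} \<Longrightarrow> b + k * t \<in> {0..S}"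
    and q: "\<And>t. t \<in> {0..T} \<Longrightarrow> q t = p (b + k * t)"
  shows "\<exists>v'. ode_sol q T (\<lambda>t. if b + k * t \<le> T then \<sigma> (b + k * t) else 0)
    (\<lambda>t. LINT s:{0..T}|lebesgue. G (b + k * t) s * \<sigma> s) v'"
  using ode_sol_isometry[OF solves_imp_ode_sol[OF S solves_green_zero_extension[OF G T \<sigma>]] k into q]
  by blast

lemma continuous_on_green_isometry:
  fixes G :: "real \<Rightarrow> real \<Rightarrow> real"
  assumes G: "continuous_on ({0..S} \<times> {0..S}) (\<lambda>(t, s). G t s)"
    and T: "T \<le> S" and into: "\<And>t. t \<in> {0..T} \<Longrightarrow> b + k * t \<in> {0..S}"
  shows "continuous_on ({0..T} \<times> {0..T}) (\<lambda>(t, s). G (b + k * t) s)"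
proof -
  have p: "continuous_on ({0..T} \<times> {0..T}) (\<lambda>x. (b + k * fst x, snd x))"
    by (intro continuous_intros)
  have "(\<lambda>x. (b + k * fst x, snd x)) ` ({0..T} \<times> {0..T}) \<subseteq> {0..S} \<times> {0..S}"
    using into T by force
  from continuous_on_compose2[OF G p this] show ?thesis
    by (simp add: case_prod_beta)
qed

lemma satisfies_bc_ends: "satisfies_bc B S u \<Longrightarrow> u 0 = u S"
  by (cases B) auto

text \<open>
  Superposition of a solution and its reflection in \<open>T\<close>.  The two right-hand sides overlap
  only at the fixed point \<open>t = T\<close>, which is a null set.
\<close>

lemma is_green_odd_reflection:
  assumes T: "0 < T" and G: "is_green B p (2 * T) G"
    and p1: "\<And>t. t \<in> {0..T} \<Longrightarrow> p t = q t" and p2: "\<And>t. t \<in> {0..T} \<Longrightarrow> p (2 * T - t) = q t"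
  shows "is_green Dirichlet q T (\<lambda>t s. G t s - G (2 * T - t) s)"
proof -
  have S: "0 < 2 * T" and TS: "T \<le> 2 * T" using T by auto
  have cG: "continuous_on ({0..2 * T} \<times> {0..2 * T}) (\<lambda>(t, s). G t s)"
    using G by (simp add: is_green_def)
  have "solves Dirichlet q T \<sigma> (\<lambda>t. LINT s:{0..T}|lebesgue. (G t s - G (2 * T - t) s) * \<sigma> s)"
    if \<sigma>: "set_integrable lebesgue {0..T} \<sigma>" for \<sigma>
  proof -
    let ?I = "\<lambda>t. LINT s:{0..T}|lebesgue. G t s * \<sigma> s"
    let ?u = "\<lambda>t. LINT s:{0..T}|lebesgue. (G t s - G (2 * T - t) s) * \<sigma> s"
    obtain v1 where v1: "ode_sol q T (\<lambda>t. if 0 + 1 * t \<le> T then \<sigma> (0 + 1 * t) else 0)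
        (\<lambda>t. ?I (0 + 1 * t)) v1"
      using ode_sol_green[OF S G TS \<sigma>, of 1 0 q] p1 by force
    obtain v2 where v2: "ode_sol q T (\<lambda>t. if 2 * T + (-1) * t \<le> T then \<sigma> (2 * T + (-1) * t) else 0)
        (\<lambda>t. ?I (2 * T + (-1) * t)) v2"
      using ode_sol_green[OF S G TS \<sigma>, of "-1" "2 * T" q] p2 by force
    note int = set_integrable_green[OF cG _ TS \<sigma>]
    have split: "?u t = ?I t - ?I (2 * T - t)" if "t \<in> {0..T}" for t
      using that set_integral_diff(2)[OF int[of t] int[of "2 * T - t"]]
      by (simp add: left_diff_distrib)
    have "ode_sol q T \<sigma> ?u (\<lambda>t. 1 * v1 t + (-1) * v2 t)"
    proof (rule ode_sol_cong[OF ode_sol_lincomb[OF v1 v2]])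
      show "AE t in lebesgue. t \<in> {0..T} \<longrightarrow>
          1 * (if 0 + 1 * t \<le> T then \<sigma> (0 + 1 * t) else 0) +
          (-1) * (if 2 * T + (-1) * t \<le> T then \<sigma> (2 * T + (-1) * t) else 0) = \<sigma> t"
        using AE_lebesgue_neq[of T] by eventually_elim auto
    qed (use split in auto)
    moreover have "?I 0 = ?I (2 * T)"
      using satisfies_bc_ends solves_green_zero_extension[OF G TS \<sigma>] unfolding solves_def by blast
    then have "satisfies_bc Dirichlet T ?u"
      using split[of 0] split[of T] T by simp
    ultimately show ?thesis
      using ode_sol_imp_solves[OF T] by blast
  qed
  moreover have "continuous_on ({0..T} \<times> {0..T}) (\<lambda>(t, s). G t s - G (2 * T - t) s)"
    using continuous_on_diff[OF continuous_on_green_isometry[OF cG TS, of 0 1]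
        continuous_on_green_isometry[OF cG TS, of "2 * T" "-1"]]
    by (simp add: case_prod_beta)
  ultimately show ?thesis by (simp add: is_green_def)
qed

text \<open>
  Superposition of four solutions.  The signs make the sum odd about \<open>T\<close>, and
  odd about \<open>0\<close> once the ends \<open>0\<close> and \<open>4T\<close> are identified.  Apart from the point
  \<open>t = T\<close>, only the unreflected, unshifted term sees the support of \<open>\<sigma>\<close>.
\<close>

lemma is_green_double_odd_reflection:
  assumes T: "0 < T" and G: "is_green B p (4 * T) G"
    and p1: "\<And>t. t \<in> {0..T} \<Longrightarrow> p t = q t" and p2: "\<And>t. t \<in> {0..T} \<Longrightarrow> p (4 * T - t) = q t"
    and p3: "\<And>t. t \<in> {0..T} \<Longrightarrow> p (2 * T - t) = q t" and p4: "\<And>t. t \<in> {0..T} \<Longrightarrow> p (2 * T + t) = q t"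
  shows "is_green Dirichlet q T
    (\<lambda>t s. G t s - G (4 * T - t) s - G (2 * T - t) s + G (2 * T + t) s)"
proof -
  let ?K = "\<lambda>t s. G t s - G (4 * T - t) s - G (2 * T - t) s + G (2 * T + t) s"
  have S: "0 < 4 * T" and TS: "T \<le> 4 * T" using T by auto
  have cG: "continuous_on ({0..4 * T} \<times> {0..4 * T}) (\<lambda>(t, s). G t s)"
    using G by (simp add: is_green_def)
  have "solves Dirichlet q T \<sigma> (\<lambda>t. LINT s:{0..T}|lebesgue. ?K t s * \<sigma> s)"
    if \<sigma>: "set_integrable lebesgue {0..T} \<sigma>" for \<sigma>
  proof -
    let ?I = "\<lambda>t. LINT s:{0..T}|lebesgue. G t s * \<sigma> s"
    let ?u = "\<lambda>t. LINT s:{0..T}|lebesgue. ?K t s * \<sigma> s"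
    let ?r = "\<lambda>b k t. if b + k * t \<le> T then \<sigma> (b + k * t) else 0"
    obtain v1 where v1: "ode_sol q T (?r 0 1) (\<lambda>t. ?I (0 + 1 * t)) v1"
      using ode_sol_green[OF S G TS \<sigma>, of 1 0 q] p1 by force
    obtain v2 where v2: "ode_sol q T (?r (4 * T) (-1)) (\<lambda>t. ?I (4 * T + (-1) * t)) v2"
      using ode_sol_green[OF S G TS \<sigma>, of "-1" "4 * T" q] p2 by force
    obtain v3 where v3: "ode_sol q T (?r (2 * T) (-1)) (\<lambda>t. ?I (2 * T + (-1) * t)) v3"
      using ode_sol_green[OF S G TS \<sigma>, of "-1" "2 * T" q] p3 by force
    obtain v4 where v4: "ode_sol q T (?r (2 * T) 1) (\<lambda>t. ?I (2 * T + 1 * t)) v4"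
      using ode_sol_green[OF S G TS \<sigma>, of 1 "2 * T" q] p4 by force
    note int = set_integrable_green[OF cG _ TS \<sigma>]
    have split: "?u t = ?I t - ?I (4 * T - t) - ?I (2 * T - t) + ?I (2 * T + t)"
      if t: "t \<in> {0..T}" for t
    proof -
      have i: "set_integrable lebesgue {0..T} (\<lambda>s. G t s * \<sigma> s)"
        "set_integrable lebesgue {0..T} (\<lambda>s. G (4 * T - t) s * \<sigma> s)"
        "set_integrable lebesgue {0..T} (\<lambda>s. G (2 * T - t) s * \<sigma> s)"
        "set_integrable lebesgue {0..T} (\<lambda>s. G (2 * T + t) s * \<sigma> s)"
        using t by (auto intro!: int)
      have "?u t = (LINT s:{0..T}|lebesgue. G t s * \<sigma> s - G (4 * T - t) s * \<sigma> s
          - G (2 * T - t) s * \<sigma> s + G (2 * T + t) s * \<sigma> s)"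
        by (simp add: algebra_simps)
      then show ?thesis
        using i by simp
    qed
    have "ode_sol q T \<sigma> ?u (\<lambda>t. 1 * (1 * v1 t + (-1) * v2 t) + 1 * ((-1) * v3 t + 1 * v4 t))"
    proof (rule ode_sol_cong[OF ode_sol_lincomb[OF ode_sol_lincomb[OF v1 v2] ode_sol_lincomb[OF v3 v4]]])
      show "AE t in lebesgue. t \<in> {0..T} \<longrightarrow>
          1 * (1 * ?r 0 1 t + (-1) * ?r (4 * T) (-1) t) +
          1 * ((-1) * ?r (2 * T) (-1) t + 1 * ?r (2 * T) 1 t) = \<sigma> t"
        using AE_lebesgue_neq[of T] T by eventually_elim auto
    qed (use split in auto)
    moreover have "?I 0 = ?I (4 * T)"
      using satisfies_bc_ends solves_green_zero_extension[OF G TS \<sigma>] unfolding solves_def by blast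
    then have "satisfies_bc Dirichlet T ?u"
      using split[of 0] split[of T] T by simp
    ultimately show ?thesis
      using ode_sol_imp_solves[OF T] by blast
  qed
  moreover have "continuous_on ({0..T} \<times> {0..T}) (\<lambda>(t, s). ?K t s)"
    using continuous_on_add[OF continuous_on_diff[OF continuous_on_diff[OF
        continuous_on_green_isometry[OF cG TS, of 0 1]
        continuous_on_green_isometry[OF cG TS, of "4 * T" "-1"]]
        continuous_on_green_isometry[OF cG TS, of "2 * T" "-1"]]
        continuous_on_green_isometry[OF cG TS, of "2 * T" 1]] T
    by (simp add: case_prod_beta)
  ultimately show ?thesis by (simp add: is_green_def)
qed

theorem mainTheorem2:
  fixes T :: real and a a2 a4 :: "real \<Rightarrow> real"
  assumes T_pos: "0 < T"
    and a_L1: "set_integrable lebesgue {0..T} a"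
  defines "a2 \<equiv> even_ext T a"
    and "a4 \<equiv> even_ext (2 * T) (even_ext T a)"
  shows
    "(\<forall>GD GP.
        nonresonant Dirichlet a T \<and> nonresonant Periodic a2 (2 * T) \<and>
        is_green Dirichlet a T GD \<and> is_green Periodic a2 (2 * T) GP \<longrightarrow>
        (\<forall>t\<in>{0..T}. \<forall>s\<in>{0..T}. GD t s = GP t s - GP (2 * T - t) s)) \<and>
     (\<forall>GD GD2.
        nonresonant Dirichlet a T \<and> nonresonant Dirichlet a2 (2 * T) \<and>
        is_green Dirichlet a T GD \<and> is_green Dirichlet a2 (2 * T) GD2 \<longrightarrow>
        (\<forall>t\<in>{0..T}. \<forall>s\<in>{0..T}. GD t s = GD2 t s - GD2 (2 * T - t) s)) \<and>
     (\<forall>GD GP.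
        nonresonant Dirichlet a T \<and> nonresonant Periodic a4 (4 * T) \<and>
        is_green Dirichlet a T GD \<and> is_green Periodic a4 (4 * T) GP \<longrightarrow>
        (\<forall>t\<in>{0..T}. \<forall>s\<in>{0..T}.
           GD t s = GP t s - GP (4 * T - t) s - GP (2 * T - t) s + GP (2 * T + t) s))"
proof -
  have a2: "a2 t = a t" "a2 (2 * T - t) = a t" if "t \<in> {0..T}" for t
    using that by (auto simp: a2_def even_ext_def)
  have a4: "a4 t = a t" "a4 (4 * T - t) = a t" "a4 (2 * T - t) = a t" "a4 (2 * T + t) = a t"
    if "t \<in> {0..T}" for t
    using that T_pos by (auto simp: a4_def even_ext_def)
  show ?thesis
    by (intro conjI allI impI ballI;
        elim conjE;
        rule is_green_unique[OF T_pos, where B = Dirichlet and q = a],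
        assumption, assumption,
        rule is_green_odd_reflection[OF T_pos] is_green_double_odd_reflection[OF T_pos],
        assumption)
      (simp_all add: a2 a4)
qed

end
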